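(* Fix constants $\ell,k\ge1$ and $d\ge\ell k+1$. For every fixed-support canonical sketch family (with parameters $k,\ell$), for all sufficiently large $V$, the following zero-error guarantee fails: $$\forall A\subseteq\mathcal U^*\text{ with }|A|=d:\qquad \Pr_\omega\big[\mathsf{Dec}^\omega(\mathsf{Enc}^\omega(A))=A\big]=1 .$$
   Context: **Universe.** $\mathcal U=\mathbb F_p$ with $p$ prime, $V=p$, $\mathcal U^*=\mathcal U\setminus\{0\}$; $V$ ranges over primes; $o_V(1)$ means tending to $0$ as $V\to\infty$ for fixed $d$; $[n]=\{1,\dots,n\}$. **Fixed-support canonical sketch family** (fixed constants $k,\ell\ge1$). For every $d,V$, a family $\mathcal A$ samples public randomness $\omega$; after fixing $\omega$, encoding and decoding are deterministic. It maintains $M_d$ persistent cells ($M_d$ depends on $d$ only, not on $V$), which hold all persistent information; each cell has at most $V^{\ell+r_d(V)}$ possible states, where $r_d(V)=o_V(1)$ for each fixed $d$. For each $\omega$ there are an encoding map $\mathsf{Enc}^\omega_{d,V}$ from subsets of $\mathcal U^*$ to sketch states and, for each $x\in\mathcal U^*$, an update map $\mathsf{Upd}^\omega_{d,V,x}$ on sketch states such that: (1) *Fixed support*: each $x\in\mathcal U^*$ has a predetermined write support $S^\omega_{d,V}(x)\subseteq[M_d]$ with $|S^\omega_{d,V}(x)|\le k$; $\mathsf{Upd}^\omega_{d,V,x}$ may depend on the whole state but changes only cells in $S^\omega_{d,V}(x)$. (2) *Canonicality*: for all $A\subseteq\mathcal U^*$ and $x\in\mathcal U^*\setminus A$, $\mathsf{Enc}^\omega_{d,V}(A\cup\{x\})=\mathsf{Upd}^\omega_{d,V,x}(\mathsf{Enc}^\omega_{d,V}(A))$.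 The decoder $\mathsf{Dec}^\omega_{d,V}$ is an arbitrary function of a pair of sketch states; on $(\mathsf{Enc}(A),\mathsf{Enc}(B))$ it aims to output $(A\setminus B,B\setminus A)$. $\mathsf{Dec}^\omega(\mathsf{Enc}^\omega(A))$ abbreviates the first component of $\mathsf{Dec}^\omega_{d,V}(\mathsf{Enc}^\omega_{d,V}(A),\mathsf{Enc}^\omega_{d,V}(\varnothing))$. *)

theory Defs
  imports "HOL-Probability.Probability" "HOL-Number_Theory.Residues"
begin

definition universe_star :: "nat \<Rightarrow> int set" where
  "universe_star V = carrier (residue_ring (int V)) - {\<zero>\<^bsub>residue_ring (int V)\<^esub>}"

text \<open>The limit \<open>V \<rightarrow> \<infinity>\<close> through the primes.\<close>

definition primes_at_top :: "nat filter" where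
  "primes_at_top = inf at_top (principal {V. prime V})"

text \<open>
  A sketch state is the tuple of contents of the cells \<open>{1..M d}\<close>, an element of
  \<open>\<Pi>\<^sub>E j\<in>{1..M d}. cell d V j\<close>, where \<open>cell d V j\<close> is the set of possible states of cell \<open>j\<close>.
  \<open>Rnd d V\<close> is the distribution of the public randomness. No measurability of the encoder in the
  randomness is required. The decoder is an arbitrary function and hence not part of the locale.
\<close>

locale fixed_support_canonical_family =
  fixes k :: nat
    and l :: real
    and M :: "nat \<Rightarrow> nat"
    and r :: "nat \<Rightarrow> nat \<Rightarrow> real"
    and Rnd :: "nat \<Rightarrow> nat \<Rightarrow> 'w measure"
    and cell :: "nat \<Rightarrow> nat \<Rightarrow> nat \<Rightarrow> 'c set"
    and Enc :: "nat \<Rightarrow> nat \<Rightarrow> 'w \<Rightarrow> int set \<Rightarrow> (nat \<Rightarrow> 'c)"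
    and Upd :: "nat \<Rightarrow> nat \<Rightarrow> 'w \<Rightarrow> int \<Rightarrow> (nat \<Rightarrow> 'c) \<Rightarrow> (nat \<Rightarrow> 'c)"
    and Supp :: "nat \<Rightarrow> nat \<Rightarrow> 'w \<Rightarrow> int \<Rightarrow> nat set"
  assumes k_ge_1: "k \<ge> 1"
    and l_ge_1: "l \<ge> 1"
    and r_tendsto_0: "\<And>d. (r d \<longlongrightarrow> 0) primes_at_top"
    and prob_space_Rnd: "\<And>d V. prime V \<Longrightarrow> prob_space (Rnd d V)"
    and finite_cell: "\<And>d V j. \<lbrakk>prime V; j \<in> {1..M d}\<rbrakk> \<Longrightarrow> finite (cell d V j)"
    and card_cell: "\<And>d V j. \<lbrakk>prime V; j \<in> {1..M d}\<rbrakk> \<Longrightarrow>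
          real (card (cell d V j)) \<le> real V powr (l + r d V)"
    and Enc_state: "\<And>d V \<omega> A. \<lbrakk>prime V; \<omega> \<in> space (Rnd d V); A \<subseteq> universe_star V\<rbrakk> \<Longrightarrow>
          Enc d V \<omega> A \<in> (\<Pi>\<^sub>E j\<in>{1..M d}. cell d V j)"
    and Upd_state: "\<And>d V \<omega> x s. \<lbrakk>prime V; \<omega> \<in> space (Rnd d V); x \<in> universe_star V;
            s \<in> (\<Pi>\<^sub>E j\<in>{1..M d}. cell d V j)\<rbrakk> \<Longrightarrow>
          Upd d V \<omega> x s \<in> (\<Pi>\<^sub>E j\<in>{1..M d}. cell d V j)"
    and Supp_subset: "\<And>d V \<omega> x. \<lbrakk>prime V; \<omega> \<in> space (Rnd d V); x \<in> universe_star V\<rbrakk> \<Longrightarrow>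
          Supp d V \<omega> x \<subseteq> {1..M d}"
    and card_Supp: "\<And>d V \<omega> x. \<lbrakk>prime V; \<omega> \<in> space (Rnd d V); x \<in> universe_star V\<rbrakk> \<Longrightarrow>
          card (Supp d V \<omega> x) \<le> k"
    and fixed_support: "\<And>d V \<omega> x s j. \<lbrakk>prime V; \<omega> \<in> space (Rnd d V); x \<in> universe_star V;
            s \<in> (\<Pi>\<^sub>E j\<in>{1..M d}. cell d V j); j \<in> {1..M d} - Supp d V \<omega> x\<rbrakk> \<Longrightarrow>
          Upd d V \<omega> x s j = s j"
    and canonical: "\<And>d V \<omega> A x. \<lbrakk>prime V; \<omega> \<in> space (Rnd d V); A \<subseteq> universe_star V;
            x \<in> universe_star V - A\<rbrakk> \<Longrightarrow>
          Enc d V \<omega> (A \<union> {x}) = Upd d V \<omega> x (Enc d V \<omega> A)"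

end

(* Zero error on the finitely many d-subsets yields a single \<omega> for which Enc is injective on all
   of them. By pigeonhole, at least (V - 1) / 2^M keys share one write support T, with card T \<le> k.
   Encoding d-subsets of these keys writes only to cells in T, so at most V powr (k * (l + o(1)))
   states arise, whereas the number of such d-subsets grows like V^d, and d > l * k. *)

theory Submission
  imports Defs
begin

lemma universe_star_eq: "prime V \<Longrightarrow> universe_star V = {1..int V - 1}"
  by (auto simp: universe_star_def residue_ring_def)

text \<open>If every fibre were below the average size \<open>card A / card B\<close>, the fibres
  could not add up to \<open>card A\<close>. The product form avoids rounding a quotient of
  naturals.\<close>

lemma pigeonhole_fibre:
  assumes "finite A" "finite B" "B \<noteq> {}" "f ` A \<subseteq> B"
  shows "\<exists>y\<in>B. card A \<le> card {x\<in>A. f x = y} * card B"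
proof (rule ccontr)
  assume "\<not> ?thesis"
  then have less: "card {x\<in>A. f x = y} * card B < card A" if "y \<in> B" for y
    using that by (meson not_le)
  have "card A = (\<Sum>y\<in>B. card {x\<in>A. f x = y})"
    using sum.group[OF assms(1,2,4), of "\<lambda>_. 1::nat"] by simp
  then have "card A * card B = (\<Sum>y\<in>B. card {x\<in>A. f x = y} * card B)"
    by (simp add: sum_distrib_right)
  also have "\<dots> < (\<Sum>y\<in>B. card A)"
    using assms(2,3) less by (intro sum_strict_mono) auto
  finally show False
    by (simp add: mult.commute)
qed

text \<open>A finite intersection of almost sure events is almost sure, hence nonempty. This turns
  zero error into a statement about one fixed \<omega>.\<close>

lemma (in prob_space) ex_common_point_of_prob_1:
  assumes "finite I" "\<And>i. i \<in> I \<Longrightarrow> prob {x \<in> space M. P i x} = 1"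
  shows "\<exists>x\<in>space M. \<forall>i\<in>I. P i x"
proof -
  have "AE x in M. P i x" if "i \<in> I" for i
  proof -
    \<comment> \<open>\<open>measure\<close> is 0 on sets that are not measurable, so the value 1
      already forces measurability.\<close>
    have "{x \<in> space M. P i x} \<in> events"
      using assms(2)[OF that] measure_notin_sets by fastforce
    then show ?thesis
      using assms(2)[OF that] prob_Collect_eq_1 by blast
  qed
  then have "AE x in M. \<forall>i\<in>I. P i x"
    using assms(1) by (simp add: AE_finite_all)
  \<comment> \<open>The inner \<open>x\<close> shadows the outer one, so the property is constant
    and \<open>AE_const\<close> removes the quantifier.\<close>
  then have "AE x in M. \<exists>x\<in>space M. \<forall>i\<in>I. P i x"
    using AE_space by eventually_elim blast
  then show ?thesis
    by (simp add: AE_const)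
qed

context fixed_support_canonical_family
begin

text \<open>Canonicality builds \<open>Enc\<close> of \<open>A\<close> from the empty set by one
  update per key, and each of these updates leaves the cells outside \<open>T\<close> alone.\<close>

lemma Enc_outside_common_support:
  assumes "prime V" "\<omega> \<in> space (Rnd d V)" "finite A" "A \<subseteq> universe_star V"
    and "\<And>x. x \<in> A \<Longrightarrow> Supp d V \<omega> x = T" and "j \<in> {1..M d} - T"
  shows "Enc d V \<omega> A j = Enc d V \<omega> {} j"
  using assms(3-5)
proof (induction A rule: finite_induct)
  case (insert x A)
  have "Enc d V \<omega> (insert x A) j = Upd d V \<omega> x (Enc d V \<omega> A) j"
    using canonical[of V \<omega> d A x] assms(1,2) insert by auto
  also have "\<dots> = Enc d V \<omega> A j"
    using assms insert by (intro fixed_support Enc_state) auto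
  also have "\<dots> = Enc d V \<omega> {} j"
    using insert by auto
  finally show ?case .
qed simp

text \<open>On subsets of \<open>C\<close> the encoding is determined by its restriction to
  \<open>T\<close>, so injectivity survives the restriction, and the \<open>n\<close>-subsets of
  \<open>C\<close> are at most as many as the joint states of the cells in \<open>T\<close>.\<close>

lemma choose_le_of_common_support:
  assumes V: "prime V" and \<omega>: "\<omega> \<in> space (Rnd d V)"
    and C: "C \<subseteq> universe_star V" "\<And>x. x \<in> C \<Longrightarrow> Supp d V \<omega> x = T" "C \<noteq> {}"
    and inj: "inj_on (Enc d V \<omega>) {A. A \<subseteq> universe_star V \<and> card A = n}"
    and nonneg: "0 \<le> l + r d V"
  shows "real (card C choose n) \<le> real V powr (real k * (l + r d V))"
proof -
  have finC: "finite C"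
    using C(1) universe_star_eq[OF V] finite_subset by fastforce
  have T: "T \<subseteq> {1..M d}" "card T \<le> k"
    using C V \<omega> Supp_subset[of V \<omega> d] card_Supp[of V \<omega> d] by blast+
  have finT: "finite T"
    using T(1) finite_subset by blast
  have state: "Enc d V \<omega> A \<in> (\<Pi>\<^sub>E j\<in>{1..M d}. cell d V j)" if "A \<subseteq> C" for A
    using that C(1) V \<omega> by (intro Enc_state) auto
  let ?S = "{A. A \<subseteq> C \<and> card A = n}"
  let ?g = "\<lambda>A. restrict (Enc d V \<omega> A) T"
  have "inj_on ?g ?S"
  proof (rule inj_onI)
    fix A B assume A: "A \<in> ?S" and B: "B \<in> ?S" and eq: "?g A = ?g B"
    have "Enc d V \<omega> A j = Enc d V \<omega> B j" for j
    proof -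
      consider "j \<in> T" | "j \<in> {1..M d} - T" | "j \<notin> {1..M d}"
        by auto
      then show ?thesis
      proof cases
        case 1
        then show ?thesis using fun_cong[OF eq, of j] by simp
      next
        case 2
        have "Enc d V \<omega> D j = Enc d V \<omega> {} j" if "D \<subseteq> C" for D
          using that C finC 2 finite_subset
          by (intro Enc_outside_common_support[OF V \<omega>, where T = T]) blast+
        from this[of A] this[of B] show ?thesis using A B by simp
      next
        case 3
        \<comment> \<open>Outside the cell indices both states have the default value
          \<open>undefined\<close>.\<close>
        have "A \<subseteq> C" "B \<subseteq> C" using A B by auto
        from PiE_arb[OF state[OF this(1)] 3] PiE_arb[OF state[OF this(2)] 3]
        show ?thesis by simp
      qed
    qed
    then have "Enc d V \<omega> A = Enc d V \<omega> B" by (rule ext)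
    then show "A = B"
      by (rule inj_onD[OF inj]) (use A B C(1) in blast)+
  qed
  moreover have "?g ` ?S \<subseteq> (\<Pi>\<^sub>E j\<in>T. cell d V j)"
    using PiE_mem[OF state] T(1) by (intro image_subsetI restrict_PiE_iff[THEN iffD2]) blast
  moreover have "finite (\<Pi>\<^sub>E j\<in>T. cell d V j)"
    using finT T(1) V finite_cell by (intro finite_PiE) auto
  ultimately have "card ?S \<le> card (\<Pi>\<^sub>E j\<in>T. cell d V j)"
    by (rule card_inj_on_le)
  then have "card C choose n \<le> (\<Prod>j\<in>T. card (cell d V j))"
    by (simp add: n_subsets[OF finC] card_PiE[OF finT])
  then have "real (card C choose n) \<le> (\<Prod>j\<in>T. real (card (cell d V j)))"
    by (simp flip: of_nat_prod)
  also have "\<dots> \<le> (\<Prod>j\<in>T. real V powr (l + r d V))"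
    using card_cell[OF V] T(1) by (intro prod_mono) auto
  also have "\<dots> = real V powr (real (card T) * (l + r d V))"
    using prime_gt_0_nat[OF V] by (simp add: powr_power)
  \<comment> \<open>\<open>T\<close> may have fewer than \<open>k\<close> cells; raising the
    exponent to \<open>k\<close> uses that \<open>l + r d V\<close> is nonnegative.\<close>
  also have "\<dots> \<le> real V powr (real k * (l + r d V))"
    using T(2) nonneg prime_ge_1_nat[OF V] by (intro powr_mono mult_right_mono) auto
  finally show ?thesis .
qed

text \<open>The gap of 1 between \<open>l * real k\<close> and \<open>d\<close> is split in two:
  half a power of \<open>V\<close> absorbs the constant factor lost in counting subsets, the other
  half absorbs \<open>real k * r d V\<close>.\<close>

lemma not_inj_on_Enc:
  assumes V: "prime V" and \<omega>: "\<omega> \<in> space (Rnd d V)"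
    and d: "l * real k + 1 \<le> real d"
    and r: "\<bar>r d V\<bar> \<le> 1 / (2 * real k)"
    and large: "(2 ^ (M d + 1) * real d) ^ d < sqrt (real V)"
       "2 ^ (M d + 1) * real d \<le> real V"
  shows "\<not> inj_on (Enc d V \<omega>) {A. A \<subseteq> universe_star V \<and> card A = d}"
proof
  assume inj: "inj_on (Enc d V \<omega>) {A. A \<subseteq> universe_star V \<and> card A = d}"
  have V2: "V \<ge> 2"
    using prime_ge_2_nat[OF V] .
  have card_U: "card (universe_star V) = V - 1" and finU: "finite (universe_star V)"
    using universe_star_eq[OF V] by (auto simp: nat_diff_distrib)
  have "Supp d V \<omega> ` universe_star V \<subseteq> Pow {1..M d}"
    using Supp_subset[OF V \<omega>] by blast
  from pigeonhole_fibre[OF finU _ _ this] obtain T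
    where T: "V - 1 \<le> card {x \<in> universe_star V. Supp d V \<omega> x = T} * 2 ^ M d"
    by (auto simp: card_U card_Pow)
  define C where "C = {x \<in> universe_star V. Supp d V \<omega> x = T}"
  \<comment> \<open>The factor \<open>2 ^ M d\<close> counts the possible supports, the extra 2 pays
    for replacing \<open>V - 1\<close> by \<open>V / 2\<close>, and \<open>d\<close> comes from the
    bound (n/d)^d on the binomial coefficient.\<close>
  let ?c = "2 ^ (M d + 1) * real d"
  have d0: "real d \<ge> 1"
    using d l_ge_1 by (smt (verit) mult_nonneg_nonneg of_nat_0_le_iff)
  have c0: "?c > 0"
    using d0 by simp
  have "real V / 2 \<le> real (V - 1)"
    using V2 by simp
  also have "\<dots> \<le> real (card C) * 2 ^ M d"
    using T[folded C_def] by (metis of_nat_le_iff of_nat_mult of_nat_numeral of_nat_power)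
  finally have cardC: "real V / ?c \<le> real (card C) / real d"
    using d0 by (simp add: field_simps)
  \<comment> \<open>This gives \<open>d \<le> card C\<close>, the condition for the binomial
    bound.\<close>
  have "1 \<le> real V / ?c"
    using large(2) c0 by (simp add: field_simps)
  then have "1 \<le> real (card C) / real d"
    using cardC by linarith
  then have dC: "d \<le> card C"
    using d0 by (simp add: field_simps)
  have "real V powr (real d - 1/2) * ?c ^ d < real V powr (real d - 1/2) * sqrt (real V)"
    using large(1) V2 by (intro mult_strict_left_mono) auto
  also have "\<dots> = real V ^ d"
    using V2 by (simp add: powr_half_sqrt[symmetric] powr_add[symmetric] powr_realpow)
  finally have "real V powr (real d - 1/2) < (real V / ?c) ^ d"
    using c0 by (simp add: power_divide pos_less_divide_eq)
  also have "\<dots> \<le> (real (card C) / real d) ^ d"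
    using cardC c0 by (intro power_mono) auto
  also have "\<dots> \<le> real (card C choose d)"
    using dC by (rule binomial_ge_n_over_k_pow_k)
  also have "\<dots> \<le> real V powr (real k * (l + r d V))"
  proof (rule choose_le_of_common_support[OF V \<omega>])
    have "1 / (2 * real k) \<le> 1"
      using k_ge_1 by (simp add: field_simps)
    then show "0 \<le> l + r d V"
      using r l_ge_1 by linarith
    show "C \<noteq> {}"
      using dC d0 by auto
  qed (use inj in \<open>auto simp: C_def\<close>)
  also have "\<dots> \<le> real V powr (real d - 1/2)"
  proof (rule powr_mono)
    have "real k * r d V \<le> 1/2"
      using r k_ge_1 by (simp add: abs_le_iff field_simps)
    then show "real k * (l + r d V) \<le> real d - 1/2"
      using d by (simp add: algebra_simps)
  qed (use V2 in simp)
  finally show False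
    by simp
qed

end

theorem theorem2:
  fixes k d :: nat and l :: real
    and M :: "nat \<Rightarrow> nat"
    and r :: "nat \<Rightarrow> nat \<Rightarrow> real"
    and Rnd :: "nat \<Rightarrow> nat \<Rightarrow> 'w measure"
    and cell :: "nat \<Rightarrow> nat \<Rightarrow> nat \<Rightarrow> 'c set"
    and Enc :: "nat \<Rightarrow> nat \<Rightarrow> 'w \<Rightarrow> int set \<Rightarrow> (nat \<Rightarrow> 'c)"
    and Upd :: "nat \<Rightarrow> nat \<Rightarrow> 'w \<Rightarrow> int \<Rightarrow> (nat \<Rightarrow> 'c) \<Rightarrow> (nat \<Rightarrow> 'c)"
    and Supp :: "nat \<Rightarrow> nat \<Rightarrow> 'w \<Rightarrow> int \<Rightarrow> nat set"
    and Dec :: "nat \<Rightarrow> nat \<Rightarrow> 'w \<Rightarrow> (nat \<Rightarrow> 'c) \<times> (nat \<Rightarrow> 'c) \<Rightarrow> int set \<times> int set"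
  assumes "l \<ge> 1" and "k \<ge> 1" and "real d \<ge> l * real k + 1"
    and "fixed_support_canonical_family k l M r Rnd cell Enc Upd Supp"
  shows "\<forall>\<^sub>F V in primes_at_top.
    \<not> (\<forall>A. A \<subseteq> universe_star V \<and> card A = d \<longrightarrow>
        \<P>(\<omega> in Rnd d V. fst (Dec d V \<omega> (Enc d V \<omega> A, Enc d V \<omega> {})) = A) = 1)"
proof -
  interpret fixed_support_canonical_family k l M r Rnd cell Enc Upd Supp
    by (rule assms(4))
  let ?c = "2 ^ (M d + 1) * real d"
  have primes: "\<forall>\<^sub>F V in primes_at_top. prime V"
    by (simp add: primes_at_top_def eventually_inf_principal)
  have "0 < 1 / (2 * real k)"
    using assms(2) by simp
  from order_tendstoD(2)[OF tendsto_rabs_zero[OF r_tendsto_0] this]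
  have small: "\<forall>\<^sub>F V in primes_at_top. \<bar>r d V\<bar> < 1 / (2 * real k)" .
  have "\<forall>\<^sub>F V in at_top. ?c ^ d < sqrt (real V) \<and> ?c \<le> real V"
  proof (rule eventually_conj)
    show "\<forall>\<^sub>F V in at_top. ?c ^ d < sqrt (real V)"
      by (rule eventually_compose_filterlim[OF eventually_gt_at_top
            filterlim_compose[OF sqrt_at_top filterlim_real_sequentially]])
    show "\<forall>\<^sub>F V in at_top. ?c \<le> real V"
      by (rule eventually_compose_filterlim[OF eventually_ge_at_top filterlim_real_sequentially])
  qed
  \<comment> \<open>\<open>primes_at_top\<close> is finer than \<open>at_top\<close>, so it inherits
    eventual properties.\<close>
  then have "\<forall>\<^sub>F V in primes_at_top. ?c ^ d < sqrt (real V) \<and> ?c \<le> real V"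
    by (rule filter_leD[rotated]) (simp add: primes_at_top_def)
  with primes small show ?thesis
  proof eventually_elim
    case (elim V)
    interpret P: prob_space "Rnd d V"
      using elim(1) by (rule prob_space_Rnd)
    let ?S = "{A. A \<subseteq> universe_star V \<and> card A = d}"
    have finS: "finite ?S"
      using universe_star_eq[OF elim(1)] by simp
    show ?case
    proof
      assume zero_error: "\<forall>A. A \<subseteq> universe_star V \<and> card A = d \<longrightarrow>
        \<P>(\<omega> in Rnd d V. fst (Dec d V \<omega> (Enc d V \<omega> A, Enc d V \<omega> {})) = A) = 1"
      have "\<exists>\<omega>\<in>space (Rnd d V). \<forall>A\<in>?S. fst (Dec d V \<omega> (Enc d V \<omega> A, Enc d V \<omega> {})) = A"
        by (rule P.ex_common_point_of_prob_1[OF finS]) (use zero_error in blast)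
      then obtain \<omega> where \<omega>: "\<omega> \<in> space (Rnd d V)"
        and dec: "\<forall>A\<in>?S. fst (Dec d V \<omega> (Enc d V \<omega> A, Enc d V \<omega> {})) = A"
        by blast
      \<comment> \<open>With the second sketch fixed to that of the empty set, the decoder is a left
        inverse of the encoder.\<close>
      have "inj_on (Enc d V \<omega>) ?S"
        using dec by (intro inj_on_inverseI[where g = "\<lambda>s. fst (Dec d V \<omega> (s, Enc d V \<omega> {}))"]) blast
      moreover have "\<not> inj_on (Enc d V \<omega>) ?S"
        using elim assms(3) by (intro not_inj_on_Enc \<omega>) auto
      ultimately show False
        by contradiction
    qed
  qed
qed

end
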